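(* Let $R=k[x,y]$ be the polynomial ring in two variables over a field $k$, and let $J$ be a monomial ideal of $R$. Write $J=(x^{a_1}y^{b_1},\ldots,x^{a_r}y^{b_r})$, where $r\ge 1$, the $a_i,b_i$ are non-negative integers, $(a_i)$ is strictly decreasing and $(b_i)$ is strictly increasing. Then $$\omega(J)=\omega^{\bullet}(J)=\begin{cases} a_1+b_1 & \text{if } r=1,\\ \max_{1\le i\le r-1}\{a_i+b_{i+1}\}-1 & \text{if } r>1.\end{cases}$$
   Context: $\mathbb{N}=\{1,2,\ldots\}$. For $N\in\mathbb{N}$, an ideal $I$ of a commutative ring $R$ with unity is $N$-absorbing if whenever $f_1,\ldots,f_{N+1}\in R$ satisfy $f_1\cdots f_{N+1}\in I$, there is some $j$ such that the product of the $f_i$ with $i\ne j$ lies in $I$. $I$ is strongly $N$-absorbing if whenever ideals $I_1,\ldots,I_{N+1}$ of $R$ satisfy $I_1\cdots I_{N+1}\subseteq I$, there is some $j$ such that the product of the $I_i$ with $i\neq j$ is contained in $I$. $\omega(I)$ (resp. $\omega^{\bullet}(I)$) is the least $N\in\mathbb{N}$ for which $I$ is $N$-absorbing (resp. strongly $N$-absorbing), or $\infty$ if there is none; by convention $\omega(R)=\omega^{\bullet}(R)=0$. A monomial ideal is an ideal generated by monomials. *)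

theory Defs
  imports
    "HOL-Computational_Algebra.Computational_Algebra"
    "HOL-Library.Extended_Nat"
begin

text \<open>
  An ideal of a commutative ring is a submodule of the ring regarded as a module over itself, so
  ideals and generated ideals are the library's \<open>module.subspace\<close> and \<open>module.span\<close> for the scalar
  multiplication \<open>(*)\<close>. The lemma below is deliberately not turned into an interpretation: this
  would globally declare \<open>a * (b * x) = (a * b) * x\<close> as a simp rule.
\<close>

lemma module_times: "module ((*) :: 'a::comm_ring_1 \<Rightarrow> 'a \<Rightarrow> 'a)"
  by unfold_locales (simp_all add: algebra_simps)

abbreviation ring_ideal :: "'a::comm_ring_1 set \<Rightarrow> bool" where
  "ring_ideal I \<equiv> module.subspace (*) I"

abbreviation ideal_gen :: "'a::comm_ring_1 set \<Rightarrow> 'a set" where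
  "ideal_gen S \<equiv> module.span (*) S"

text \<open>
  The product of a finite family of ideals is the ideal generated by all products of one element
  from each member; the empty product is the whole ring.
\<close>

definition ideal_prod :: "('i \<Rightarrow> 'a::comm_ring_1 set) \<Rightarrow> 'i set \<Rightarrow> 'a set" where
  "ideal_prod I A = ideal_gen {\<Prod>i\<in>A. f i |f. \<forall>i\<in>A. f i \<in> I i}"

definition absorbing :: "nat \<Rightarrow> 'a::comm_ring_1 set \<Rightarrow> bool" where
  "absorbing N I \<longleftrightarrow>
    (\<forall>f :: nat \<Rightarrow> 'a. (\<Prod>i\<in>{1..N+1}. f i) \<in> I \<longrightarrow>
      (\<exists>j\<in>{1..N+1}. (\<Prod>i\<in>{1..N+1} - {j}. f i) \<in> I))"

definition strongly_absorbing :: "nat \<Rightarrow> 'a::comm_ring_1 set \<Rightarrow> bool" where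
  "strongly_absorbing N I \<longleftrightarrow>
    (\<forall>K :: nat \<Rightarrow> 'a set. (\<forall>i\<in>{1..N+1}. ring_ideal (K i)) \<longrightarrow> ideal_prod K {1..N+1} \<subseteq> I \<longrightarrow>
      (\<exists>j\<in>{1..N+1}. ideal_prod K ({1..N+1} - {j}) \<subseteq> I))"

text \<open>
  The least \<open>N \<ge> 1\<close> for which the ideal is (strongly) \<open>N\<close>-absorbing, with value \<open>0\<close> for the whole
  ring by convention.
\<close>

definition absorbing_number :: "'a::comm_ring_1 set \<Rightarrow> enat" (\<open>\<omega>\<close>) where
  "\<omega> I =
    (if I = UNIV then 0
     else if \<exists>N\<ge>1. absorbing N I then enat (LEAST N. 1 \<le> N \<and> absorbing N I)
     else \<infinity>)"

definition strong_absorbing_number :: "'a::comm_ring_1 set \<Rightarrow> enat" (\<open>\<omega>\<^sup>\<bullet>\<close>) where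
  "\<omega>\<^sup>\<bullet> I =
    (if I = UNIV then 0
     else if \<exists>N\<ge>1. strongly_absorbing N I then enat (LEAST N. 1 \<le> N \<and> strongly_absorbing N I)
     else \<infinity>)"

text \<open>
  The ring \<open>k[x,y]\<close> is represented as \<open>k[y][x]\<close>, i.e. as \<open>'k poly poly\<close>: the outer indeterminate
  is \<open>x\<close>, the inner one is \<open>y\<close>.
\<close>

definition var_x :: "'k::field poly poly" where
  "var_x = [:0, 1:]"

definition var_y :: "'k::field poly poly" where
  "var_y = [:[:0, 1:]:]"

definition monomial_ideal :: "'k::field poly poly set \<Rightarrow> bool" where
  "monomial_ideal J \<longleftrightarrow> (\<exists>S \<subseteq> {var_x ^ i * var_y ^ j |i j. True}. J = ideal_gen S)"

end

theory Submission
  imports Defs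
begin

text \<open>
  Write \<open>m = (x, y)\<close>, let \<open>c = a\<^sub>r\<close> and \<open>d = b\<^sub>1\<close> be the exponents of the greatest common divisor of
  the generators, and let \<open>M\<close> be the claimed value. A polynomial lies in a monomial ideal iff all
  its monomials do, so everything is decided by the upward closed set of exponent pairs of the
  monomials in \<open>J\<close>; the pairs outside it form the region below a staircase.

  For the upper bound (\<open>strongly_absorbing_exponents_subset\<close>) the key inclusion is
  \<open>(x\<^sup>c) \<inter> (y\<^sup>d) \<inter> m\<^sup>M \<subseteq> J\<close>: for \<open>r > 1\<close> a maximal monomial outside \<open>J\<close> that is divisible
  by \<open>x\<^sup>c y\<^sup>d\<close> has exponents \<open>(a\<^sub>i - 1, b\<^bsub>i+1\<^esub> - 1)\<close>, hence degree less than \<open>M\<close>. Let a product of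
  \<open>M + 1\<close> ideals be contained in \<open>J\<close>. If one of them is not contained in \<open>m\<close>, it has an element with
  nonzero constant term; such an element is a nonzerodivisor modulo the monomial ideal \<open>J\<close>
  (\<open>exponents_subset_cancel\<close>), so this ideal can be omitted. Otherwise every subproduct of \<open>M\<close> of
  the ideals lies in \<open>m\<^sup>M\<close>. As \<open>x\<close> is prime, at most \<open>c\<close> of the ideals already have a product inside
  \<open>(x\<^sup>c)\<close>, and likewise at most \<open>d\<close> of them one inside \<open>(y\<^sup>d)\<close>
  (\<open>prime_power_dvd_small_subproduct\<close>). Since \<open>c + d \<le> M\<close>, some ideal is not among those, and it
  can be omitted.

  For the lower bound it suffices to find \<open>M\<close> elements with product in \<open>J\<close> none of which can be
  omitted (\<open>absorbing_numbers_eqI\<close>). If \<open>r = 1\<close>, these are \<open>a\<^sub>1\<close> copies of \<open>x\<close> and \<open>b\<^sub>1\<close> copies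
  of \<open>y\<close>. If \<open>r > 1\<close> and \<open>i\<close> attains the maximum, put \<open>p = a\<^sub>i - 1\<close> and \<open>q = b\<^bsub>i+1\<^esub> - 1\<close>, so that
  \<open>(p, q)\<close> is an inner corner of the staircase, and take \<open>p\<close> copies of \<open>x\<close>, \<open>q\<close> copies of \<open>y\<close>, and
  \<open>x + y\<close>. Their product has only the monomials \<open>x\<^bsup>p+1\<^esup> y\<^sup>q\<close> and \<open>x\<^sup>p y\<^bsup>q+1\<^esup>\<close>, both in \<open>J\<close>, whereas
  omitting any factor leaves a polynomial that contains the monomial \<open>x\<^sup>p y\<^sup>q \<notin> J\<close>.
\<close>

section \<open>Absorbing ideals in an arbitrary commutative ring\<close>

lemma ring_ideal_mult:
  "ring_ideal I \<Longrightarrow> p \<in> I \<Longrightarrow> q * p \<in> I"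
  by (rule module.subspace_scale[OF module_times])

lemma ideal_prod_subset_iff:
  assumes "ring_ideal I"
  shows "ideal_prod K A \<subseteq> I \<longleftrightarrow> (\<forall>f. (\<forall>i\<in>A. f i \<in> K i) \<longrightarrow> (\<Prod>i\<in>A. f i) \<in> I)"
proof -
  let ?P = "{\<Prod>i\<in>A. f i |f. \<forall>i\<in>A. f i \<in> K i}"
  have "ideal_prod K A \<subseteq> I \<longleftrightarrow> ?P \<subseteq> I"
  proof
    assume "ideal_prod K A \<subseteq> I"
    with module.span_superset[OF module_times, of ?P] show "?P \<subseteq> I"
      unfolding ideal_prod_def by (rule order_trans)
  next
    assume "?P \<subseteq> I"
    then show "ideal_prod K A \<subseteq> I"
      unfolding ideal_prod_def using assms by (rule module.span_minimal[OF module_times])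
  qed
  then show ?thesis by auto
qed

text \<open>Elements are replaced by the principal ideals that they generate.\<close>

lemma strongly_absorbing_imp_absorbing:
  assumes I: "ring_ideal I" and "strongly_absorbing N I"
  shows "absorbing N I"
  unfolding absorbing_def
proof (intro allI impI)
  fix f :: "nat \<Rightarrow> 'a"
  assume f: "(\<Prod>i\<in>{1..N+1}. f i) \<in> I"
  define K where "K i = ideal_gen {f i}" for i
  have K: "K i = range (\<lambda>r. r * f i)" for i
    unfolding K_def by (rule module.span_singleton[OF module_times])
  have "ring_ideal (K i)" for i
    unfolding K_def by (rule module.subspace_span[OF module_times])
  moreover have "ideal_prod K {1..N+1} \<subseteq> I"
    unfolding ideal_prod_subset_iff[OF I]
  proof (intro allI impI)
    fix g assume "\<forall>i\<in>{1..N+1}. g i \<in> K i"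
    then have "\<forall>i\<in>{1..N+1}. \<exists>r. g i = r * f i" by (auto simp: K)
    then obtain r where "\<forall>i\<in>{1..N+1}. g i = r i * f i" by metis
    then have "(\<Prod>i\<in>{1..N+1}. g i) = (\<Prod>i\<in>{1..N+1}. r i) * (\<Prod>i\<in>{1..N+1}. f i)"
      by (simp add: prod.distrib)
    then show "(\<Prod>i\<in>{1..N+1}. g i) \<in> I" using ring_ideal_mult[OF I f] by simp
  qed
  ultimately obtain j where j: "j \<in> {1..N+1}" "ideal_prod K ({1..N+1} - {j}) \<subseteq> I"
    using assms(2) unfolding strongly_absorbing_def by blast
  moreover have "f i \<in> K i" for i
    unfolding K_def by (rule module.span_base[OF module_times]) simp
  ultimately show "\<exists>j\<in>{1..N+1}. (\<Prod>i\<in>{1..N+1} - {j}. f i) \<in> I"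
    unfolding ideal_prod_subset_iff[OF I] by blast
qed

text \<open>
  Merging the last two of \<open>N + 2\<close> factors gives \<open>N + 1\<close> factors. If the merged factor is the one that
  can be omitted, then the product of the first \<open>N\<close> factors is already in \<open>I\<close>.
\<close>

lemma absorbing_Suc:
  assumes I: "ring_ideal I" and N: "absorbing N I"
  shows "absorbing (Suc N) I"
  unfolding absorbing_def
proof (intro allI impI)
  fix f :: "nat \<Rightarrow> 'a"
  assume f: "(\<Prod>i\<in>{1..Suc N+1}. f i) \<in> I"
  define g where "g = f(Suc N := f (Suc N) * f (Suc (Suc N)))"
  have "(\<Prod>i\<in>{1..N+1}. g i) = (\<Prod>i\<in>{1..Suc N+1}. f i)"
    by (simp add: g_def mult.assoc)
  with f N obtain j where j: "j \<in> {1..N+1}" "(\<Prod>i\<in>{1..N+1} - {j}. g i) \<in> I"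
    unfolding absorbing_def by metis
  have "(\<Prod>i\<in>{1..Suc N+1} - {j}. f i) \<in> I"
  proof (cases "j = Suc N")
    case True
    then have "{1..N+1} - {j} = {1..N}" "{1..Suc N+1} - {j} = insert (Suc (Suc N)) {1..N}"
      by auto
    with j(2) show ?thesis using ring_ideal_mult[OF I] by (simp add: g_def)
  next
    case False
    then have "{1..N+1} - {j} = insert (Suc N) ({1..N} - {j})"
      "{1..Suc N+1} - {j} = insert (Suc (Suc N)) (insert (Suc N) ({1..N} - {j}))"
      using j(1) by auto
    moreover have "(\<Prod>i\<in>{1..N} - {j}. g i) = (\<Prod>i\<in>{1..N} - {j}. f i)"
      by (intro prod.cong) (auto simp: g_def)
    ultimately show ?thesis using j(2) by (simp add: g_def ac_simps)
  qed
  then show "\<exists>j\<in>{1..Suc N+1}. (\<Prod>i\<in>{1..Suc N+1} - {j}. f i) \<in> I" using j(1) by force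
qed

lemma absorbing_mono:
  assumes "ring_ideal I" "absorbing n I" "n \<le> N"
  shows "absorbing N I"
  using assms(3,2) by (induction rule: dec_induct) (auto intro: absorbing_Suc assms(1))

text \<open>
  By monotonicity it is enough to refute the case \<open>n = size F - 1\<close>, where the elements of \<open>F\<close> are
  themselves a counterexample. A multiset is used because the factors repeat and their order is
  irrelevant.
\<close>

lemma not_absorbing_if_irredundant_product:
  assumes I: "ring_ideal I"
    and F: "prod_mset F \<in> I" "\<And>f. f \<in># F \<Longrightarrow> prod_mset (F - {#f#}) \<notin> I"
    and n: "n < size F"
  shows "\<not> absorbing n I"
proof
  assume "absorbing n I"
  then have abs: "absorbing (size F - 1) I" using absorbing_mono[OF I] n by simp
  obtain xs where xs: "mset xs = F" using ex_mset by blast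
  define f where "f i = xs ! (i - 1)" for i
  define A where "A = {1..(size F - 1) + 1}"
  have A: "finite A" "A = {1..length xs}" using n xs by (auto simp: A_def)
  have "mset_set A = mset [1..<Suc (length xs)]"
    by (simp only: A(2) mset_upt atLeastLessThanSuc_atLeastAtMost)
  then have "image_mset f (mset_set A) = mset (map f [1..<Suc (length xs)])"
    by (simp only: mset_map)
  also have "map f [1..<Suc (length xs)] = xs"
    by (intro nth_equalityI) (auto simp: f_def simp del: upt_Suc)
  finally have fA: "image_mset f (mset_set A) = F" by (simp add: xs)
  have "(\<Prod>i\<in>A. f i) \<in> I" using F(1) by (simp add: prod_unfold_prod_mset fA)
  with abs obtain j where j: "j \<in> A" "(\<Prod>i\<in>A - {j}. f i) \<in> I"
    unfolding absorbing_def A_def by blast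
  have "f j \<in># F" unfolding fA[symmetric] using j(1) A(1) by simp
  moreover have "(\<Prod>i\<in>A - {j}. f i) = prod_mset (F - {#f j#})"
    using j(1) A(1)
    by (simp add: prod_unfold_prod_mset mset_set_Diff image_mset_Diff flip: fA)
  ultimately show False using F(2) j(2) by simp
qed

text \<open>
  The criterion by which both invariants are computed. It also covers \<open>N = 0\<close>: then \<open>F\<close> is empty, so
  \<open>1 \<in> I\<close> and the convention for the whole ring applies.
\<close>

lemma absorbing_numbers_eqI:
  assumes I: "ring_ideal I" and N: "strongly_absorbing N I"
    and F: "prod_mset F \<in> I" "\<And>f. f \<in># F \<Longrightarrow> prod_mset (F - {#f#}) \<notin> I" "size F = N"
  shows "\<omega> I = enat N \<and> \<omega>\<^sup>\<bullet> I = enat N"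
proof (cases "N = 0")
  case True
  then have "1 \<in> I" using F by simp
  then have "I = UNIV" using ring_ideal_mult[OF I, of 1] by auto
  then show ?thesis
    using True by (simp add: absorbing_number_def strong_absorbing_number_def zero_enat_def)
next
  case False
  then have "F \<noteq> {#}" using F(3) by auto
  then have "I \<noteq> UNIV" using F(2) by (metis UNIV_I multiset_nonemptyE)
  have low: "N \<le> n" if "absorbing n I" for n
    using not_absorbing_if_irredundant_product[OF I F(1,2)] F(3) that by (meson not_le)
  have lows: "N \<le> n" if "strongly_absorbing n I" for n
    using low strongly_absorbing_imp_absorbing[OF I that] by simp
  have Na: "absorbing N I" by (rule strongly_absorbing_imp_absorbing[OF I N])
  have "(LEAST n. 1 \<le> n \<and> absorbing n I) = N"
    using Na low False by (intro Least_equality) auto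
  moreover have "(LEAST n. 1 \<le> n \<and> strongly_absorbing n I) = N"
    using N lows False by (intro Least_equality) auto
  moreover have "1 \<le> N" using False by simp
  ultimately show ?thesis
    using \<open>I \<noteq> UNIV\<close> N Na by (auto simp: absorbing_number_def strong_absorbing_number_def)
qed

section \<open>Prime powers dividing a product of sets\<close>

text \<open>
  The valuation at a prime element is additive on products. Stating it by
  divisibility makes sense of it in any integral domain.
\<close>

lemma prime_elem_power_dvd_prod_le:
  fixes f :: "'i \<Rightarrow> 'a::idom"
  assumes p: "prime_elem p" and "finite A"
    and f: "\<And>i. i \<in> A \<Longrightarrow> p ^ v i dvd f i" "\<And>i. i \<in> A \<Longrightarrow> \<not> p ^ Suc (v i) dvd f i"
    and dvd: "p ^ c dvd (\<Prod>i\<in>A. f i)"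
  shows "c \<le> (\<Sum>i\<in>A. v i)"
proof (rule ccontr)
  assume "\<not> ?thesis"
  then have c: "Suc (\<Sum>i\<in>A. v i) \<le> c" by simp
  have "\<forall>i\<in>A. \<exists>g. f i = p ^ v i * g" using f(1) by (auto simp: dvd_def)
  then obtain g where g: "\<And>i. i \<in> A \<Longrightarrow> f i = p ^ v i * g i" by metis
  have g_ndvd: "\<forall>i\<in>A. \<not> p dvd g i"
    using f(2) g by (auto simp: power_Suc2 simp del: power_Suc)
  have "\<not> p dvd 1" using p by (simp add: prime_elem_def)
  have "\<not> p dvd (\<Prod>i\<in>A. g i)"
    using \<open>finite A\<close> g_ndvd
    by (induction A rule: finite_induct) (simp_all add: prime_elem_dvd_mult_iff[OF p] \<open>\<not> p dvd 1\<close>)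
  have "(\<Prod>i\<in>A. f i) = p ^ (\<Sum>i\<in>A. v i) * (\<Prod>i\<in>A. g i)"
    using g by (simp add: prod.distrib power_sum)
  moreover have "p ^ (\<Sum>i\<in>A. v i) * p dvd (\<Prod>i\<in>A. f i)"
    using dvd power_le_dvd[OF _ c] by (simp add: mult.commute)
  ultimately have "p dvd (\<Prod>i\<in>A. g i)" using p by (simp add: prime_elem_def)
  with \<open>\<not> p dvd (\<Prod>i\<in>A. g i)\<close> show False ..
qed

text \<open>Collecting only indices with \<open>v i > 0\<close>, each new index raises the sum by at least one.\<close>

lemma small_subset_sum_ge:
  fixes v :: "'i \<Rightarrow> nat"
  assumes "finite A" "c \<le> sum v A"
  shows "\<exists>S\<subseteq>A. card S \<le> c \<and> c \<le> sum v S"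
  using assms(2)
proof (induction c)
  case 0
  then show ?case by (intro exI[of _ "{}"]) simp
next
  case (Suc c)
  then obtain S where S: "S \<subseteq> A" "card S \<le> c" "c \<le> sum v S" by auto
  then have "finite S" using assms(1) finite_subset by blast
  show ?case
  proof (cases "Suc c \<le> sum v S")
    case True
    then show ?thesis using S by (intro exI[of _ S]) simp
  next
    case False
    have "\<exists>i\<in>A - S. v i \<noteq> 0"
    proof (rule ccontr)
      assume "\<not> ?thesis"
      then have "sum v S = sum v A" using S(1) assms(1) by (intro sum.mono_neutral_left) auto
      then show False using False Suc.prems by simp
    qed
    then obtain i where "i \<in> A" "i \<notin> S" "v i \<noteq> 0" by blast
    then show ?thesis using S \<open>finite S\<close> by (intro exI[of _ "insert i S"]) auto
  qed
qed

text \<open>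
  The valuation of a product of sets is the sum of the least valuations of their elements, and a sum
  of naturals that reaches \<open>c\<close> does so with at most \<open>c\<close> summands.
\<close>

lemma prime_power_dvd_small_subproduct:
  fixes K :: "'i \<Rightarrow> 'a::idom set"
  assumes p: "prime_elem p" and A: "finite A"
    and dvd: "\<forall>f. (\<forall>i\<in>A. f i \<in> K i) \<longrightarrow> p ^ c dvd (\<Prod>i\<in>A. f i)"
  shows "\<exists>S\<subseteq>A. card S \<le> c \<and> (\<forall>f. (\<forall>i\<in>S. f i \<in> K i) \<longrightarrow> p ^ c dvd (\<Prod>i\<in>S. f i))"
proof -
  (* v i is the least valuation on K i, capped at c: the cap makes it well defined if K i is
     empty or contains only 0. *)
  define V where "V i = {v. v \<le> c \<and> (\<forall>f\<in>K i. p ^ v dvd f)}" for i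
  define v where "v i = Max (V i)" for i
  have "finite (V i)" "0 \<in> V i" for i by (auto simp: V_def)
  then have "v i \<in> V i" and max: "w \<in> V i \<Longrightarrow> w \<le> v i" for i w
    unfolding v_def by (auto intro: Max_in)
  then have v: "v i \<le> c" "f \<in> K i \<Longrightarrow> p ^ v i dvd f" for i f
    by (auto simp: V_def)
  have "c \<le> sum v A"
  proof (cases "\<exists>i\<in>A. v i = c")
    case True
    then show ?thesis using A by (metis member_le_sum zero_le)
  next
    case False
    have "\<forall>i\<in>A. \<exists>f\<in>K i. \<not> p ^ Suc (v i) dvd f"
    proof
      fix i assume "i \<in> A"
      then have "Suc (v i) \<le> c" using v(1)[of i] False by (metis le_neq_implies_less Suc_leI)
      then show "\<exists>f\<in>K i. \<not> p ^ Suc (v i) dvd f"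
        using max[of "Suc (v i)" i] by (auto simp: V_def)
    qed
    then obtain f where f: "\<And>i. i \<in> A \<Longrightarrow> f i \<in> K i" "\<And>i. i \<in> A \<Longrightarrow> \<not> p ^ Suc (v i) dvd f i"
      by metis
    then have "p ^ c dvd (\<Prod>i\<in>A. f i)" using dvd by blast
    then show ?thesis
      by (rule prime_elem_power_dvd_prod_le[OF p A _ f(2), rotated -1]) (use v(2) f(1) in auto)
  qed
  then obtain S where S: "S \<subseteq> A" "card S \<le> c" "c \<le> sum v S"
    using small_subset_sum_ge[OF A] by blast
  have "p ^ c dvd (\<Prod>i\<in>S. f i)" if "\<forall>i\<in>S. f i \<in> K i" for f
  proof -
    have "(\<Prod>i\<in>S. p ^ v i) dvd (\<Prod>i\<in>S. f i)" using v(2) that by (intro prod_dvd_prod) auto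
    then show ?thesis using S(3) by (metis power_le_dvd power_sum)
  qed
  with S(1,2) show ?thesis by blast
qed

section \<open>Monomial ideals as sets of polynomials with restricted exponents\<close>

definition exponents :: "'k::field poly poly \<Rightarrow> (nat \<times> nat) set" where
  "exponents p = {(i, j). coeff (coeff p i) j \<noteq> 0}"

definition up_closed :: "(nat \<times> nat) set \<Rightarrow> bool" where
  "up_closed E \<longleftrightarrow> (\<forall>i j k l. (i, j) \<in> E \<longrightarrow> i \<le> k \<longrightarrow> j \<le> l \<longrightarrow> (k, l) \<in> E)"

lemma up_closedD: "up_closed E \<Longrightarrow> (i, j) \<in> E \<Longrightarrow> i \<le> k \<Longrightarrow> j \<le> l \<Longrightarrow> (k, l) \<in> E"
  unfolding up_closed_def by blast

lemma exponents_add: "exponents (p + q) \<subseteq> exponents p \<union> exponents q"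
  by (auto simp: exponents_def)

lemma coeff_coeff_mult:
  "coeff (coeff (p * q) i) j =
    (\<Sum>(k, l)\<in>{..i} \<times> {..j}. coeff (coeff p k) l * coeff (coeff q (i - k)) (j - l))"
  by (simp add: coeff_mult coeff_sum sum.cartesian_product)

lemma exponents_mult:
  assumes "(i, j) \<in> exponents (p * q)"
  obtains k l where "k \<le> i" "l \<le> j" "(k, l) \<in> exponents p" "(i - k, j - l) \<in> exponents q"
proof -
  have "(\<Sum>(k, l)\<in>{..i} \<times> {..j}. coeff (coeff p k) l * coeff (coeff q (i - k)) (j - l)) \<noteq> 0"
    using assms unfolding exponents_def by (simp add: coeff_coeff_mult)
  then obtain k l where "k \<le> i" "l \<le> j"
    "coeff (coeff p k) l * coeff (coeff q (i - k)) (j - l) \<noteq> 0"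
    by (elim sum.not_neutral_contains_not_neutral) auto
  then show thesis using that by (auto simp: exponents_def)
qed

lemma ring_ideal_exponents_subset:
  assumes "up_closed E"
  shows "ring_ideal {p :: 'k::field poly poly. exponents p \<subseteq> E}"
proof (rule module.subspaceI[OF module_times])
  show "0 \<in> {p :: 'k poly poly. exponents p \<subseteq> E}" by (simp add: exponents_def)
next
  fix p q :: "'k poly poly"
  assume "p \<in> {p. exponents p \<subseteq> E}" "q \<in> {p. exponents p \<subseteq> E}"
  then show "p + q \<in> {p. exponents p \<subseteq> E}" using exponents_add[of p q] by blast
next
  fix p q :: "'k poly poly"
  assume "q \<in> {p. exponents p \<subseteq> E}"
  then show "p * q \<in> {p. exponents p \<subseteq> E}"
    using up_closedD[OF assms] by (auto elim!: exponents_mult)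
qed

lemma var_power_mult_eq_monom: "var_x ^ i * var_y ^ j = monom (monom 1 j) i"
proof -
  have "var_x ^ i = (monom 1 i :: 'a poly poly)" by (simp add: var_x_def monom_altdef)
  moreover have "var_y ^ j = ([:monom 1 j:] :: 'a poly poly)"
    by (simp add: var_y_def monom_altdef poly_const_pow)
  ultimately show ?thesis by (simp add: smult_monom)
qed

lemma exponents_monom: "c \<noteq> 0 \<Longrightarrow> exponents (monom (monom c j) i) = {(i, j)}"
  by (auto simp: exponents_def split: if_splits)

lemma monom_eq_mult_var:
  assumes "k \<le> i" "l \<le> j"
  shows "monom (monom c j) i = monom (monom c (j - l)) (i - k) * (var_x ^ k * var_y ^ l)"
  using assms by (simp add: var_power_mult_eq_monom mult_monom)

text \<open>
  Every monomial of a polynomial on the right is a multiple of some generator, and the polynomial is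
  the sum of its monomials.
\<close>

lemma ideal_gen_monomials:
  "ideal_gen {var_x ^ a t * var_y ^ b t |t. t \<in> T} =
    {p :: 'k::field poly poly. exponents p \<subseteq> {(i, j). \<exists>t\<in>T. a t \<le> i \<and> b t \<le> j}}"
  (is "ideal_gen ?G = {p. exponents p \<subseteq> ?E}")
proof
  have "up_closed ?E" unfolding up_closed_def by (auto intro: order_trans)
  then show "ideal_gen ?G \<subseteq> {p. exponents p \<subseteq> ?E}"
    by (intro module.span_minimal[OF module_times _ ring_ideal_exponents_subset])
      (auto simp: var_power_mult_eq_monom exponents_monom)
next
  show "{p. exponents p \<subseteq> ?E} \<subseteq> ideal_gen ?G"
  proof
    fix p :: "'k poly poly"
    assume "p \<in> {p. exponents p \<subseteq> ?E}"
    then have p: "exponents p \<subseteq> ?E" by simp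
    note ideal = module.subspace_span[OF module_times, of ?G]
    have "monom (monom (coeff (coeff p i) j) j) i \<in> ideal_gen ?G" for i j
    proof (cases "coeff (coeff p i) j = 0")
      case True
      then show ?thesis using module.subspace_0[OF module_times ideal] by simp
    next
      case False
      then obtain t where t: "t \<in> T" "a t \<le> i" "b t \<le> j" using p by (auto simp: exponents_def)
      have "var_x ^ a t * var_y ^ b t \<in> ideal_gen ?G"
        using t(1) by (intro module.span_base[OF module_times]) blast
      then show ?thesis
        unfolding monom_eq_mult_var[OF t(2,3)] by (rule ring_ideal_mult[OF ideal])
    qed
    then have "(\<Sum>i\<le>degree p. \<Sum>j\<le>degree (coeff p i). monom (monom (coeff (coeff p i) j) j) i)
        \<in> ideal_gen ?G"
      by (intro module.subspace_sum[OF module_times ideal])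
    moreover have "(\<Sum>j\<le>degree (coeff p i). monom (monom (coeff (coeff p i) j) j) i) =
        monom (coeff p i) i" for i
      by (simp add: poly_as_sum_of_monoms flip: monom_sum)
    ultimately show "p \<in> ideal_gen ?G" by (simp add: poly_as_sum_of_monoms)
  qed
qed

lemma var_x_power_dvd_iff:
  fixes p :: "'k::field poly poly"
  shows "var_x ^ c dvd p \<longleftrightarrow> exponents p \<subseteq> {(i, j). c \<le> i}"
proof -
  have "var_x ^ c dvd p \<longleftrightarrow> p \<in> ideal_gen {var_x ^ c * var_y ^ 0}"
    by (auto simp: module.span_singleton[OF module_times] dvd_def mult.commute)
  also have "\<dots> \<longleftrightarrow> exponents p \<subseteq> {(i, j). c \<le> i}"
    using ideal_gen_monomials[where 'k = 'k and a = "\<lambda>_. c" and b = "\<lambda>_. 0" and T = "{()}"] by simp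
  finally show ?thesis .
qed

lemma var_y_power_dvd_iff:
  fixes p :: "'k::field poly poly"
  shows "var_y ^ d dvd p \<longleftrightarrow> exponents p \<subseteq> {(i, j). d \<le> j}"
proof -
  have "var_y ^ d dvd p \<longleftrightarrow> p \<in> ideal_gen {var_x ^ 0 * var_y ^ d}"
    by (auto simp: module.span_singleton[OF module_times] dvd_def mult.commute)
  also have "\<dots> \<longleftrightarrow> exponents p \<subseteq> {(i, j). d \<le> j}"
    using ideal_gen_monomials[where 'k = 'k and a = "\<lambda>_. 0" and b = "\<lambda>_. d" and T = "{()}"] by simp
  finally show ?thesis .
qed

lemma prime_elem_indeterminate: "prime_elem ([:0, 1:] :: 'a::idom poly)"
proof -
  have "[:0, 1:] dvd p \<longleftrightarrow> poly p 0 = 0" for p :: "'a poly"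
    using poly_eq_0_iff_dvd[of p 0] by simp
  then show ?thesis by (intro prime_elemI) auto
qed

lemma prime_elem_var_x: "prime_elem var_x"
  unfolding var_x_def by (rule prime_elem_indeterminate)

lemma prime_elem_var_y: "prime_elem var_y"
  unfolding var_y_def by (rule lift_prime_elem_poly[OF prime_elem_indeterminate])

section \<open>The upper bound\<close>

text \<open>
  In \<open>p q\<close>, the coefficient at a pair \<open>(i, j) \<notin> E\<close> involves only coefficients of \<open>p\<close> at smaller
  pairs, which are again outside \<open>E\<close> and vanish by induction on \<open>i + j\<close>. What remains is the
  coefficient of \<open>p\<close> at \<open>(i, j)\<close> times the constant term of \<open>q\<close>.
\<close>

lemma exponents_subset_cancel:
  assumes E: "up_closed E" and pq: "exponents (p * q) \<subseteq> E" and q: "(0, 0) \<in> exponents q"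
  shows "exponents p \<subseteq> E"
proof -
  have "(i, j) \<notin> E \<Longrightarrow> coeff (coeff p i) j = 0" for i j
  proof (induction "i + j" arbitrary: i j rule: less_induct)
    case less
    have zero: "k = i \<and> l = j" if "coeff (coeff p k) l \<noteq> 0" "k \<le> i" "l \<le> j" for k l
    proof (rule ccontr)
      assume "\<not> ?thesis"
      then have "k + l < i + j" using that(2,3) by linarith
      moreover have "(k, l) \<notin> E" using that(2,3) less.prems up_closedD[OF E] by blast
      ultimately show False using less.hyps that(1) by blast
    qed
    have "0 = coeff (coeff (p * q) i) j"
      using pq less.prems by (auto simp: exponents_def)
    also have "\<dots> = (\<Sum>(k, l)\<in>{(i, j)}. coeff (coeff p k) l * coeff (coeff q (i - k)) (j - l))"
      unfolding coeff_coeff_mult by (rule sum.mono_neutral_right) (auto dest: zero)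
    finally show ?case using q by (simp add: exponents_def)
  qed
  then show ?thesis by (auto simp: exponents_def)
qed

text \<open>A product of \<open>n\<close> elements of \<open>(x, y)\<close> lies in \<open>(x, y)\<^sup>n\<close>.\<close>

lemma exponents_prod_degree_ge:
  assumes "finite A" "\<And>t. t \<in> A \<Longrightarrow> (0, 0) \<notin> exponents (f t)"
  shows "exponents (\<Prod>t\<in>A. f t) \<subseteq> {(i, j). card A \<le> i + j}"
  using assms
proof (induction A rule: finite_induct)
  case (insert t A)
  show ?case
  proof clarify
    fix i j assume "(i, j) \<in> exponents (\<Prod>t\<in>insert t A. f t)"
    then have "(i, j) \<in> exponents (f t * (\<Prod>t\<in>A. f t))" using insert.hyps by simp
    then obtain k l where kl: "k \<le> i" "l \<le> j" "(k, l) \<in> exponents (f t)"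
      "(i - k, j - l) \<in> exponents (\<Prod>t\<in>A. f t)" by (rule exponents_mult)
    have "(0, 0) \<notin> exponents (f t)" using insert.prems by blast
    with kl(3) have "k + l \<noteq> 0" by (metis add_is_0)
    moreover have "card A \<le> (i - k) + (j - l)" using insert.IH insert.prems kl(4) by blast
    moreover have "card (insert t A) = Suc (card A)" using insert.hyps by simp
    ultimately show "card (insert t A) \<le> i + j" using kl(1,2) by linarith
  qed
qed simp

text \<open>
  The assumptions say \<open>(x\<^sup>c) \<inter> (y\<^sup>d) \<inter> (x, y)\<^sup>M \<subseteq> J \<subseteq> (x\<^sup>c y\<^sup>d)\<close>. If all factors lie in
  \<open>(x, y)\<close>, the omitted one only has to be chosen outside the \<open>c + d\<close> or fewer factors that
  account for divisibility by \<open>x\<^sup>c\<close> and \<open>y\<^sup>d\<close>; the remaining \<open>M\<close> factors provide the degree.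
\<close>

lemma strongly_absorbing_exponents_subset:
  fixes E :: "(nat \<times> nat) set"
  defines "J \<equiv> {p :: 'k::field poly poly. exponents p \<subseteq> E}"
  assumes E: "up_closed E" and cd: "c + d \<le> M"
    and lower: "\<And>i j. (i, j) \<in> E \<Longrightarrow> c \<le> i \<and> d \<le> j"
    and upper: "\<And>i j. c \<le> i \<Longrightarrow> d \<le> j \<Longrightarrow> M \<le> i + j \<Longrightarrow> (i, j) \<in> E"
  shows "strongly_absorbing M J"
  unfolding strongly_absorbing_def
proof (intro allI impI)
  fix K :: "nat \<Rightarrow> 'k poly poly set"
  define A where "A = {1..M+1}"
  have J: "ring_ideal J" unfolding J_def by (rule ring_ideal_exponents_subset[OF E])
  assume "ideal_prod K {1..M+1} \<subseteq> J"
  then have K: "exponents (\<Prod>i\<in>A. f i) \<subseteq> E" if "\<And>i. i \<in> A \<Longrightarrow> f i \<in> K i" for f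
    using that unfolding ideal_prod_subset_iff[OF J] by (auto simp: J_def A_def)
  have A: "finite A" "card A = Suc M" by (simp_all add: A_def)
  have "\<exists>j\<in>A. \<forall>f. (\<forall>i\<in>A - {j}. f i \<in> K i) \<longrightarrow> exponents (\<Prod>i\<in>A - {j}. f i) \<subseteq> E"
  proof (cases "\<exists>j\<in>A. \<exists>q\<in>K j. (0, 0) \<in> exponents q")
    case True
    then obtain j q where j: "j \<in> A" "q \<in> K j" "(0, 0) \<in> exponents q" by blast
    have "exponents (\<Prod>i\<in>A - {j}. f i) \<subseteq> E" if f: "\<forall>i\<in>A - {j}. f i \<in> K i" for f
    proof -
      have "(\<Prod>i\<in>A. (f(j := q)) i) = (\<Prod>i\<in>A - {j}. f i) * q"
        by (subst prod.remove[OF A(1) j(1)]) (simp add: mult.commute)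
      moreover have "exponents (\<Prod>i\<in>A. (f(j := q)) i) \<subseteq> E" by (rule K) (use f j in auto)
      ultimately show ?thesis using exponents_subset_cancel[OF E _ j(3)] by simp
    qed
    with j(1) show ?thesis by blast
  next
    case False
    have "\<forall>f. (\<forall>i\<in>A. f i \<in> K i) \<longrightarrow> var_x ^ c dvd (\<Prod>i\<in>A. f i)"
      unfolding var_x_power_dvd_iff using K lower by blast
    from prime_power_dvd_small_subproduct[OF prime_elem_var_x A(1) this]
    obtain S where S: "S \<subseteq> A" "card S \<le> c"
      "\<And>f. \<forall>i\<in>S. f i \<in> K i \<Longrightarrow> var_x ^ c dvd (\<Prod>i\<in>S. f i)"
      by blast
    have "\<forall>f. (\<forall>i\<in>A. f i \<in> K i) \<longrightarrow> var_y ^ d dvd (\<Prod>i\<in>A. f i)"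
      unfolding var_y_power_dvd_iff using K lower by blast
    from prime_power_dvd_small_subproduct[OF prime_elem_var_y A(1) this]
    obtain T where T: "T \<subseteq> A" "card T \<le> d"
      "\<And>f. \<forall>i\<in>T. f i \<in> K i \<Longrightarrow> var_y ^ d dvd (\<Prod>i\<in>T. f i)"
      by blast
    have "card (S \<union> T) < card A" using card_Un_le[of S T] S(2) T(2) cd A(2) by linarith
    then have "\<not> A \<subseteq> S \<union> T" using S(1) T(1) A(1) by (metis Un_subset_iff card_mono finite_subset not_le)
    then obtain j where j: "j \<in> A" "j \<notin> S \<union> T" by blast
    have "exponents (\<Prod>i\<in>A - {j}. f i) \<subseteq> E" if f: "\<forall>i\<in>A - {j}. f i \<in> K i" for f
    proof -
      let ?P = "\<Prod>i\<in>A - {j}. f i"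
      have ST: "S \<subseteq> A - {j}" "T \<subseteq> A - {j}" using S(1) T(1) j(2) by auto
      have "(\<Prod>i\<in>S. f i) dvd ?P" "(\<Prod>i\<in>T. f i) dvd ?P"
        using ST A(1) by (auto intro: prod_dvd_prod_subset)
      moreover have "var_x ^ c dvd (\<Prod>i\<in>S. f i)" by (rule S(3)) (use f ST in auto)
      moreover have "var_y ^ d dvd (\<Prod>i\<in>T. f i)" by (rule T(3)) (use f ST in auto)
      ultimately have "var_x ^ c dvd ?P" "var_y ^ d dvd ?P" by (blast intro: dvd_trans)+
      then have xy: "exponents ?P \<subseteq> {(i, j). c \<le> i}" "exponents ?P \<subseteq> {(i, j). d \<le> j}"
        by (simp_all add: var_x_power_dvd_iff var_y_power_dvd_iff)
      have "exponents ?P \<subseteq> {(i, k). card (A - {j}) \<le> i + k}"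
        by (rule exponents_prod_degree_ge) (use False f A(1) in auto)
      then have deg: "exponents ?P \<subseteq> {(i, k). M \<le> i + k}" using A j(1) by simp
      show ?thesis
      proof clarify
        fix i k assume "(i, k) \<in> exponents ?P"
        with xy deg have "c \<le> i" "d \<le> k" "M \<le> i + k" by blast+
        then show "(i, k) \<in> E" by (rule upper)
      qed
    qed
    with j(1) show ?thesis by blast
  qed
  then show "\<exists>j\<in>{1..M+1}. ideal_prod K ({1..M+1} - {j}) \<subseteq> J"
    unfolding ideal_prod_subset_iff[OF J] by (simp add: J_def A_def)
qed

section \<open>The lower bound\<close>

lemma exponents_corner_product:
  fixes p q :: nat
  shows "exponents ((var_x + var_y) * (var_x ^ p * var_y ^ q) :: 'k::field poly poly) =
    {(Suc p, q), (p, Suc q)}"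
proof -
  have "(var_x + var_y) * (var_x ^ p * var_y ^ q) =
      (var_x ^ Suc p * var_y ^ q + var_x ^ p * var_y ^ Suc q :: 'k poly poly)"
    by (simp add: algebra_simps)
  also have "\<dots> = monom (monom 1 q) (Suc p) + monom (monom 1 (Suc q)) p"
    by (simp only: var_power_mult_eq_monom)
  finally show ?thesis by (auto simp: exponents_def split: if_splits)
qed

text \<open>
  A single \<open>x + y\<close> suffices as a replacement for both \<open>x\<close> and \<open>y\<close>: once a factor \<open>x\<close> is missing, the
  summand \<open>x\<close> of \<open>x + y\<close> restores the monomial \<open>x\<^sup>p y\<^sup>q\<close>, and symmetrically for \<open>y\<close>.
\<close>

lemma corner_irredundant:
  fixes E :: "(nat \<times> nat) set"
  defines "J \<equiv> {f :: 'k::field poly poly. exponents f \<subseteq> E}"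
  assumes E: "(p, q) \<notin> E" "(Suc p, q) \<in> E" "(p, Suc q) \<in> E"
  defines "F \<equiv> replicate_mset p var_x + replicate_mset q var_y + {#var_x + var_y#}"
  shows "prod_mset F \<in> J" "f \<in># F \<Longrightarrow> prod_mset (F - {#f#}) \<notin> J"
proof -
  show "prod_mset F \<in> J"
    using E(2,3) by (simp add: F_def J_def exponents_corner_product)
  assume "f \<in># F"
  then consider (x) p' where "p = Suc p'" "f = var_x" | (y) q' where "q = Suc q'" "f = var_y"
    | (sum) "f = var_x + var_y"
    unfolding F_def by (cases p; cases q) (auto split: if_splits)
  then have "(p, q) \<in> exponents (prod_mset (F - {#f#}))"
  proof cases
    case x
    then have "F - {#f#} = replicate_mset p' var_x + replicate_mset q var_y + {#var_x + var_y#}"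
      by (simp add: F_def)
    then show ?thesis using x by (simp add: exponents_corner_product)
  next
    case y
    then have "F - {#f#} = replicate_mset p var_x + replicate_mset q' var_y + {#var_x + var_y#}"
      by (simp add: F_def)
    then show ?thesis using y by (simp add: exponents_corner_product)
  next
    case sum
    then have "F - {#f#} = replicate_mset p var_x + replicate_mset q var_y"
      by (simp add: F_def)
    then show ?thesis by (simp add: var_power_mult_eq_monom exponents_monom)
  qed
  with E(1) show "prod_mset (F - {#f#}) \<notin> J" by (auto simp: J_def)
qed

text \<open>
  A principal monomial ideal has no inner corner, but there the powers of \<open>x\<close> and \<open>y\<close> in the generator
  are all indispensable.
\<close>

lemma monomial_irredundant:
  fixes p q :: nat
  defines "J \<equiv> {f :: 'k::field poly poly. exponents f \<subseteq> {(i, j). p \<le> i \<and> q \<le> j}}"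
  defines "F \<equiv> replicate_mset p var_x + replicate_mset q var_y"
  shows "prod_mset F \<in> J" "f \<in># F \<Longrightarrow> prod_mset (F - {#f#}) \<notin> J"
proof -
  show "prod_mset F \<in> J"
    by (simp add: F_def J_def var_power_mult_eq_monom exponents_monom)
  assume "f \<in># F"
  then consider (x) p' where "p = Suc p'" "f = var_x" | (y) q' where "q = Suc q'" "f = var_y"
    unfolding F_def by (cases p; cases q) (auto split: if_splits)
  then show "prod_mset (F - {#f#}) \<notin> J"
  proof cases
    case x
    then have "F - {#f#} = replicate_mset p' var_x + replicate_mset q var_y"
      by (simp add: F_def)
    then show ?thesis using x by (simp add: J_def var_power_mult_eq_monom exponents_monom)
  next
    case y
    then have "F - {#f#} = replicate_mset p var_x + replicate_mset q' var_y"
      by (simp add: F_def)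
    then show ?thesis using y by (simp add: J_def var_power_mult_eq_monom exponents_monom)
  qed
qed

section \<open>The absorbing numbers of a monomial ideal in two variables\<close>

theorem theorem2:
  fixes J :: "'k::field poly poly set" and r :: nat and a b :: "nat \<Rightarrow> nat"
  assumes "monomial_ideal J"
    and "1 \<le> r"
    and "strict_antimono_on {1..r} a"
    and "strict_mono_on {1..r} b"
    and "J = ideal_gen {var_x ^ a i * var_y ^ b i |i. i \<in> {1..r}}"
  shows "\<omega> J = \<omega>\<^sup>\<bullet> J \<and>
    \<omega>\<^sup>\<bullet> J = enat (if r = 1 then a 1 + b 1
                else Max {a i + b (i + 1) |i. i \<in> {1..r - 1}} - 1)"
proof -
  define E where "E = {(i, j). \<exists>t\<in>{1..r}. a t \<le> i \<and> b t \<le> j}"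
  have J: "J = {p. exponents p \<subseteq> E}"
    unfolding assms(5) E_def by (rule ideal_gen_monomials)
  have E: "up_closed E" unfolding up_closed_def E_def by (auto intro: order_trans)
  have ideal: "ring_ideal J" unfolding J by (rule ring_ideal_exponents_subset[OF E])
  have a: "a t < a s" if "1 \<le> s" "s < t" "t \<le> r" for s t
    using assms(3) that by (auto simp: monotone_on_def)
  have b: "b s < b t" if "1 \<le> s" "s < t" "t \<le> r" for s t
    using assms(4) that by (auto simp: monotone_on_def)
  have lower: "a r \<le> i \<and> b 1 \<le> j" if "(i, j) \<in> E" for i j
  proof -
    obtain t where t: "1 \<le> t" "t \<le> r" "a t \<le> i" "b t \<le> j" using \<open>(i, j) \<in> E\<close> by (auto simp: E_def)
    have "a r \<le> a t" using a[of t r] t by (cases "t = r") auto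
    moreover have "b 1 \<le> b t" using b[of 1 t] t by (cases "t = 1") auto
    ultimately show ?thesis using t by linarith
  qed
  show ?thesis
  proof (cases "r = 1")
    case True
    then have E1: "E = {(i, j). a 1 \<le> i \<and> b 1 \<le> j}" by (auto simp: E_def)
    have strong: "strongly_absorbing (a 1 + b 1) J"
      unfolding J by (rule strongly_absorbing_exponents_subset[OF E order_refl]) (auto simp: E1)
    have "\<omega> J = enat (a 1 + b 1) \<and> \<omega>\<^sup>\<bullet> J = enat (a 1 + b 1)"
      using strong ideal unfolding J E1
      by (intro absorbing_numbers_eqI[where
            F = "replicate_mset (a 1) var_x + replicate_mset (b 1) var_y"]
          monomial_irredundant) auto
    then show ?thesis using True by simp
  next
    case False
    define S where "S = {a i + b (i + 1) |i. i \<in> {1..r - 1}}"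
    have "S = (\<lambda>i. a i + b (i + 1)) ` {1..r - 1}" by (auto simp: S_def)
    then have S: "finite S" "S \<noteq> {}" using False assms(2) by auto
    obtain m where m: "1 \<le> m" "m < r" "Max S = a m + b (Suc m)"
      using Max_in[OF S] by (auto simp: S_def)
    have am: "a (Suc m) < a m" and bm: "b m < b (Suc m)" using a b m by auto
    define p where "p = a m - 1"
    define q where "q = b (Suc m) - 1"
    have pq: "a m = Suc p" "b (Suc m) = Suc q" using am bm by (auto simp: p_def q_def)
    define M where "M = Max S - 1"
    have M: "M = Suc (p + q)" using pq m(3) by (simp add: M_def)
    have strong: "strongly_absorbing M J"
      unfolding J
    proof (rule strongly_absorbing_exponents_subset[OF E _ lower])
      have "a r \<le> p" using a[of m r] m pq by simp
      moreover have "b 1 \<le> q" using b[of 1 "Suc m"] m pq by simp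
      ultimately show "a r + b 1 \<le> M" using M by simp
    next
      fix i j assume ij: "a r \<le> i" "b 1 \<le> j" "M \<le> i + j"
      (* If t > 1 is the first step of the staircase with a t \<le> i, then i < a (t - 1), and a large
         degree i + j forces j up to the height b t. *)
      define t where "t = (LEAST t. 1 \<le> t \<and> a t \<le> i)"
      have t: "1 \<le> t" "a t \<le> i"
        using LeastI[of "\<lambda>t. 1 \<le> t \<and> a t \<le> i" r] ij(1) assms(2) by (auto simp: t_def)
      have "t \<le> r" unfolding t_def using ij(1) assms(2) by (intro Least_le) auto
      have "b t \<le> j"
      proof (cases "t = 1")
        case True
        then show ?thesis using ij by simp
      next
        case False
        then have "i < a (t - 1)"
          using not_less_Least[of "t - 1" "\<lambda>t. 1 \<le> t \<and> a t \<le> i", folded t_def] t(1)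
          by auto
        moreover have "a (t - 1) + b t \<in> S"
          unfolding S_def using False t(1) \<open>t \<le> r\<close> by (intro CollectI exI[of _ "t - 1"]) auto
        then have "a (t - 1) + b t \<le> Max S" using S(1) by simp
        ultimately show ?thesis using ij(3) by (simp add: M_def)
      qed
      then show "(i, j) \<in> E" using t \<open>t \<le> r\<close> by (auto simp: E_def)
    qed
    have "(p, q) \<notin> E"
    proof
      assume "(p, q) \<in> E"
      then obtain t where t: "1 \<le> t" "t \<le> r" "a t < a m" "b t < b (Suc m)"
        using pq by (auto simp: E_def less_Suc_eq_le)
      have "m < t" using a[of t m] t m by (metis less_asym' linorder_neqE_nat less_imp_le less_irrefl)
      then have "b (Suc m) \<le> b t" using b[of "Suc m" t] t by (cases "t = Suc m") auto
      with t show False by simp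
    qed
    moreover have "(Suc p, q) \<in> E"
      unfolding E_def using m pq bm by (auto intro!: bexI[of _ m])
    moreover have "(p, Suc q) \<in> E"
      unfolding E_def using m pq am by (auto intro!: bexI[of _ "Suc m"])
    ultimately have "\<omega> J = enat M \<and> \<omega>\<^sup>\<bullet> J = enat M"
      unfolding J using strong[unfolded J] ideal[unfolded J]
      by (intro absorbing_numbers_eqI[where
            F = "replicate_mset p var_x + replicate_mset q var_y + {#var_x + var_y#}"]
          corner_irredundant) (auto simp: M)
    then show ?thesis using False by (simp add: M_def S_def)
  qed
qed

end
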